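(* Let $\Gamma=\mathrm{SC}(G,R,R,S)$ be a semi-Cayley graph over a finite abelian group $G$ of order $n$ whose eigenvalues $\lambda_z^\pm$ ($z\in G$) are all integers, let $\alpha,\beta$ be nonzero complex numbers, let $g,h\in G$ and $a=g^{-1}h$. (a) Let $G_0=\{z\in G:\chi_a(z)=1\}$, $G_1=\{z\in G:\chi_a(z)=-1\}$, suppose $G_1\neq\emptyset$ and fix $z_1\in G_1$; let $M=\gcd(M_0^+,M_0^-,M_1^+,M_1^-)$ where $M_0^+=\gcd(|R|+|S|-\lambda_z^+:z\in G_0)$, $M_0^-=\gcd(|R|-|S|-\lambda_z^-:z\in G_0)$, $M_1^+=\gcd(\lambda_{z_1}^+-\lambda_z^+:z\in G_1)$, $M_1^-=\gcd(\lambda_{z_1}^--\lambda_z^-:z\in G_1)$. If $M=1$, then $(\alpha,\beta)$-revival does not occur on $\Gamma$ from $u=(g,r)$ to $v=(h,s)$ with $r=s$. (b) Let $H_0=\{z\in G:\chi_z(S)\chi_a(z)=|\chi_z(S)|\}$, $H_1=\{z\in G:\chi_z(S)\chi_a(z)=-|\chi_z(S)|\}$, suppose $H_1\neq\emptyset$ and fix $z_1\in H_1$; let $N=\gcd(N_0^+,N_0^-,N_1^+,N_1^-,N_2^+,N_2^-)$ where $N_0^+=\gcd(|R|+|S|-\lambda_z^+:z\in H_0)$, $N_0^-=\gcd(|R|-|S|-\lambda_z^-:z\in H_0)$, $N_1^+=\gcd(|R|+|S|-\lambda_z^-:z\in H_1)$, $N_1^-=\gcd(|R|-|S|-\lambda_z^+:z\in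 H_1)$, $N_2^+=\gcd(\lambda_{z_1}^+-\lambda_z^+:z\in H_1)$, $N_2^-=\gcd(\lambda_{z_1}^--\lambda_z^-:z\in H_1)$. If $N=1$, then $(\alpha,\beta)$-revival does not occur on $\Gamma$ from $u=(g,r)$ to $v=(h,s)$ with $r\neq s$.
   Context: $G$ is a finite abelian group of order $n$, written multiplicatively with identity $1$, identified with $\mathbb{Z}_{n_1}\otimes\cdots\otimes\mathbb{Z}_{n_r}$. For $z=(z_1,\dots,z_r)$, $g=(g_1,\dots,g_r)$ in $G$, $\chi_z(g)=\prod_{s=1}^r\omega_{n_s}^{z_sg_s}$ with $\omega_m=\exp(2\pi\imath/m)$; note $\chi_z(g)=\chi_g(z)$. For $Y\subseteq G$, $\chi_z(Y)=\sum_{y\in Y}\chi_z(y)$. $R,S\subseteq G$ with $R=R^{-1}$, $1\notin R$. The semi-Cayley graph $\mathrm{SC}(G,R,R,S)$ has vertex set $\{(g,0),(g,1):g\in G\}$ and edges $\{(g,0),(h,0)\}$ and $\{(g,1),(h,1)\}$ for $hg^{-1}\in R$, and $\{(g,0),(h,1)\}$ for $hg^{-1}\in S$. Its eigenvalues are $\lambda_z^\pm=\chi_z(R)\pm|\chi_z(S)|$, $z\in G$. The transition matrix is $H(t)=\exp(\imath tA)$, $A$ the adjacency matrix. For distinct vertices $u,v$, $(\alpha,\beta)$-revival occurs from $u$ to $v$ at time $t$ if $H(t)\mathbf{e}_u=\alpha\mathbf{e}_u+\beta\mathbf{e}_v$ with $|\alpha|^2+|\beta|^2=1$.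
   Formalization: In (b), for r=0 and s=1, the sets H_0 and H_1 are formed with a^{-1} in place of a, because the criterion as stated fails there (G=Z_4×Z_3, R={(0,1),(0,2)}, S={(1,0)}, a=(1,0)); the case r=1, s=0 and part (a) are as stated. *)

theory Defs
  imports "HOL-Analysis.Analysis" "HOL-Algebra.Product_Groups" "HOL-Algebra.Coset"
begin

section \<open>Characters of a finite abelian group\<close>

text \<open>
  The identification of the abstract group G with a product of k cyclic groups of orders
  n 0, ..., n (k - 1) is a group isomorphism phi from G to
  \<^term>\<open>product_group {..<k} (\<lambda>s. integer_mod_group (n s))\<close>; the characters are taken with
  respect to phi.
\<close>

definition root_of_unity_exp :: "nat \<Rightarrow> complex" where
  "root_of_unity_exp m = exp (2 * of_real pi * \<i> / of_nat m)"

definition gchar :: "nat \<Rightarrow> (nat \<Rightarrow> nat) \<Rightarrow> ('a \<Rightarrow> nat \<Rightarrow> int) \<Rightarrow> 'a \<Rightarrow> 'a \<Rightarrow> complex" where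
  "gchar k n \<phi> z g = (\<Prod>s<k. root_of_unity_exp (n s) powi (\<phi> z s * \<phi> g s))"

definition gchar_set :: "nat \<Rightarrow> (nat \<Rightarrow> nat) \<Rightarrow> ('a \<Rightarrow> nat \<Rightarrow> int) \<Rightarrow> 'a \<Rightarrow> 'a set \<Rightarrow> complex" where
  "gchar_set k n \<phi> z Y = (\<Sum>y\<in>Y. gchar k n \<phi> z y)"

definition lambda_plus ::
    "nat \<Rightarrow> (nat \<Rightarrow> nat) \<Rightarrow> ('a \<Rightarrow> nat \<Rightarrow> int) \<Rightarrow> 'a set \<Rightarrow> 'a set \<Rightarrow> 'a \<Rightarrow> complex" where
  "lambda_plus k n \<phi> R S z = gchar_set k n \<phi> z R + of_real (cmod (gchar_set k n \<phi> z S))"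

definition lambda_minus ::
    "nat \<Rightarrow> (nat \<Rightarrow> nat) \<Rightarrow> ('a \<Rightarrow> nat \<Rightarrow> int) \<Rightarrow> 'a set \<Rightarrow> 'a set \<Rightarrow> 'a \<Rightarrow> complex" where
  "lambda_minus k n \<phi> R S z = gchar_set k n \<phi> z R - of_real (cmod (gchar_set k n \<phi> z S))"

text \<open>
  The gcd of a set of complex numbers all of which are integers (non-integers would be ignored);
  the gcd of the set containing only 0 is 0.
\<close>

definition int_gcd :: "complex set \<Rightarrow> int" where
  "int_gcd X = Gcd {m. of_int m \<in> X}"


section \<open>Complex matrices indexed by a finite set\<close>

text \<open>
  A matrix with index set V is a function of two arguments, only its values on V being relevant.
\<close>

type_synonym 'v cmatrix = "'v \<Rightarrow> 'v \<Rightarrow> complex"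

definition mat_vec :: "'v set \<Rightarrow> 'v cmatrix \<Rightarrow> ('v \<Rightarrow> complex) \<Rightarrow> 'v \<Rightarrow> complex" where
  "mat_vec V A x = (\<lambda>u. \<Sum>v\<in>V. A u v * x v)"

definition mat_prod :: "'v set \<Rightarrow> 'v cmatrix \<Rightarrow> 'v cmatrix \<Rightarrow> 'v cmatrix" where
  "mat_prod V A B = (\<lambda>u v. \<Sum>w\<in>V. A u w * B w v)"

primrec mat_power :: "'v set \<Rightarrow> 'v cmatrix \<Rightarrow> nat \<Rightarrow> 'v cmatrix" where
  "mat_power V A 0 = (\<lambda>u v. if u = v then 1 else 0)"
| "mat_power V A (Suc j) = mat_prod V A (mat_power V A j)"

definition mat_exp :: "'v set \<Rightarrow> 'v cmatrix \<Rightarrow> 'v cmatrix" where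
  "mat_exp V A = (\<lambda>u v. \<Sum>j. mat_power V A j u v / fact j)"

definition mat_eigenvalue :: "'v set \<Rightarrow> 'v cmatrix \<Rightarrow> complex \<Rightarrow> bool" where
  "mat_eigenvalue V A \<mu> \<longleftrightarrow>
     (\<exists>x. (\<exists>v\<in>V. x v \<noteq> 0) \<and> (\<forall>v\<in>V. mat_vec V A x v = \<mu> * x v))"

definition unit_vec :: "'v \<Rightarrow> 'v \<Rightarrow> complex" where
  "unit_vec u = (\<lambda>v. if v = u then 1 else 0)"


section \<open>Graphs, transition matrices and revival\<close>

text \<open>A graph is given by its vertex set V and its set E of edges (two-element subsets of V).\<close>

definition adj_matrix :: "'v set set \<Rightarrow> 'v cmatrix" where
  "adj_matrix E = (\<lambda>u v. if {u, v} \<in> E then 1 else 0)"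

definition transition_matrix :: "'v set \<Rightarrow> 'v set set \<Rightarrow> real \<Rightarrow> 'v cmatrix" where
  "transition_matrix V E t = mat_exp V (\<lambda>u v. \<i> * of_real t * adj_matrix E u v)"

definition revival_at ::
    "'v set \<Rightarrow> 'v set set \<Rightarrow> complex \<Rightarrow> complex \<Rightarrow> 'v \<Rightarrow> 'v \<Rightarrow> real \<Rightarrow> bool" where
  "revival_at V E \<alpha> \<beta> u v t \<longleftrightarrow>
     u \<in> V \<and> v \<in> V \<and> u \<noteq> v \<and> (cmod \<alpha>)\<^sup>2 + (cmod \<beta>)\<^sup>2 = 1 \<and>
     (\<forall>w\<in>V. mat_vec V (transition_matrix V E t) (unit_vec u) w
               = \<alpha> * unit_vec u w + \<beta> * unit_vec v w)"

definition revival_occurs ::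
    "'v set \<Rightarrow> 'v set set \<Rightarrow> complex \<Rightarrow> complex \<Rightarrow> 'v \<Rightarrow> 'v \<Rightarrow> bool" where
  "revival_occurs V E \<alpha> \<beta> u v \<longleftrightarrow> (\<exists>t. revival_at V E \<alpha> \<beta> u v t)"


section \<open>Semi-Cayley graphs\<close>

definition sc_verts :: "('a, 'b) monoid_scheme \<Rightarrow> ('a \<times> nat) set" where
  "sc_verts G = carrier G \<times> {0, 1}"

definition sc_edges ::
    "('a, 'b) monoid_scheme \<Rightarrow> 'a set \<Rightarrow> 'a set \<Rightarrow> 'a set \<Rightarrow> ('a \<times> nat) set set" where
  "sc_edges G R L S =
     {{(g, 0), (h, 0)} | g h. g \<in> carrier G \<and> h \<in> carrier G \<and> h \<otimes>\<^bsub>G\<^esub> inv\<^bsub>G\<^esub> g \<in> R} \<union>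
     {{(g, 1), (h, 1)} | g h. g \<in> carrier G \<and> h \<in> carrier G \<and> h \<otimes>\<^bsub>G\<^esub> inv\<^bsub>G\<^esub> g \<in> L} \<union>
     {{(g, 0), (h, 1)} | g h. g \<in> carrier G \<and> h \<in> carrier G \<and> h \<otimes>\<^bsub>G\<^esub> inv\<^bsub>G\<^esub> g \<in> S}"

text \<open>
  For revival between the two levels, S is oriented from level 0 to level 1, and reversing the
  direction replaces S by its inverse set. Let chi denote the character at z and let a be g^-1 h.
  For a vertex (g, 1) and a target (h, 0) the relevant quantity is chi(S) chi(a); for (g, 0) and
  (h, 1) it is chi(S) chi(a^-1). Using chi(S) chi(a) in the second case gives a false criterion:
  in Z_4 x Z_3 with R = {(0,1), (0,2)}, S = {(1,0)} and a = (1,0) the gcd N formed with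
  chi(S) chi(a) is 1, but at time 2 pi / 3 there is revival from ((0,0), 0) to ((1,0), 1).
  The element below is a for r = 1 and a^-1 for r = 0, where r is the level of the starting vertex.
\<close>

definition level_shift :: "('a, 'b) monoid_scheme \<Rightarrow> nat \<Rightarrow> 'a \<Rightarrow> 'a" where
  "level_shift G r a = (if r = 1 then a else inv\<^bsub>G\<^esub> a)"

end

theory Submission
  imports Defs
begin

text \<open>
  Pairing revival H(t) e_u = alpha e_u + beta e_v with an eigenvector f of the symmetric matrix A
  for the eigenvalue lambda gives exp(i t lambda) f(u) = alpha f(u) + beta f(v). Writing chi(S) as
  c |chi(S)| with |c| = 1, the function equal to c chi on level 0 and to epsilon chi on level 1
  (epsilon = 1 or -1) is an eigenvector for chi(R) + epsilon |chi(S)|. Each of these relations on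
  G_0, G_1 (or H_0, H_1) says that exp(i t lambda) is alpha + beta or alpha - beta, so exp(i t m) = 1
  for all the differences m whose gcd is taken. If the gcd is 1, then exp(i t) = 1, hence
  exp(i t lambda) = 1 for all the integral eigenvalues. As both values occur,
  alpha + beta = 1 = alpha - beta, contradicting that beta is nonzero.
\<close>

section \<open>Matrix exponentials and eigenvectors\<close>

text \<open>Each of the \<open>card V\<close> summands in a matrix product contributes a factor of
  at most \<open>B\<close>. This crude geometric bound makes the exponential series comparable with
  a scalar one.\<close>

lemma cmod_mat_power_le:
  assumes "finite V" and B: "\<And>u v. u \<in> V \<Longrightarrow> v \<in> V \<Longrightarrow> cmod (A u v) \<le> B"
    and "u \<in> V" "v \<in> V"
  shows "cmod (mat_power V A j u v) \<le> (real (card V) * B) ^ j"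
  using \<open>u \<in> V\<close>
proof (induction j arbitrary: u)
  case 0
  then show ?case by simp
next
  case (Suc j)
  have "B \<ge> 0"
    using B[OF Suc.prems Suc.prems] norm_ge_zero order_trans by blast
  have "cmod (mat_power V A (Suc j) u v) \<le> (\<Sum>w\<in>V. cmod (A u w * mat_power V A j w v))"
    by (simp add: mat_prod_def norm_sum)
  also have "\<dots> \<le> (\<Sum>w\<in>V. B * (real (card V) * B) ^ j)"
    using Suc \<open>B \<ge> 0\<close> B by (intro sum_mono) (auto simp: norm_mult intro!: mult_mono)
  finally show ?case
    by (simp add: mult.assoc)
qed

lemma summable_mat_exp:
  assumes "finite V" "u \<in> V" "v \<in> V"
  shows "summable (\<lambda>j. mat_power V A j u v / fact j)"
proof -
  \<comment> \<open>The sum of the moduli of all entries serves as a uniform bound on the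
    entries.\<close>
  define B where "B = (\<Sum>p\<in>V. \<Sum>q\<in>V. cmod (A p q))"
  have B: "cmod (A p q) \<le> B" if "p \<in> V" "q \<in> V" for p q
  proof -
    have "cmod (A p q) \<le> (\<Sum>q\<in>V. cmod (A p q))"
      using that \<open>finite V\<close> by (intro member_le_sum) auto
    also have "\<dots> \<le> B"
      unfolding B_def using that \<open>finite V\<close>
      by (intro member_le_sum[of p V "\<lambda>p. \<Sum>q\<in>V. cmod (A p q)"]) (auto intro: sum_nonneg)
    finally show ?thesis .
  qed
  show ?thesis
  proof (rule summable_comparison_test')
    show "summable (\<lambda>j. inverse (fact j) * (real (card V) * B) ^ j)"
      by (rule summable_exp)
    show "norm (mat_power V A j u v / fact j) \<le> inverse (fact j) * (real (card V) * B) ^ j"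
      if "j \<ge> 0" for j
      using cmod_mat_power_le[OF \<open>finite V\<close> B \<open>u \<in> V\<close> \<open>v \<in> V\<close>, where j = j]
      by (simp add: norm_divide divide_simps)
  qed
qed

text \<open>\<open>mat_power\<close> adds each new factor \<open>A\<close> on the left, so a row
  vector \<open>f\<close> meets the newest factor first and every induction step peels off one
  \<mu>.\<close>

lemma left_eigenvector_mat_power:
  assumes "finite V" and eig: "\<And>w. w \<in> V \<Longrightarrow> (\<Sum>u\<in>V. f u * A u w) = \<mu> * f w" and "v \<in> V"
  shows "(\<Sum>u\<in>V. f u * mat_power V A j u v) = \<mu> ^ j * f v"
proof (induction j)
  case 0
  show ?case
    using \<open>finite V\<close> \<open>v \<in> V\<close> by (simp add: if_distrib cong: if_cong)
next
  case (Suc j)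
  have "(\<Sum>u\<in>V. f u * mat_power V A (Suc j) u v) =
        (\<Sum>u\<in>V. \<Sum>w\<in>V. f u * A u w * mat_power V A j w v)"
    by (simp add: mat_prod_def sum_distrib_left mult.assoc)
  also have "\<dots> = (\<Sum>w\<in>V. (\<Sum>u\<in>V. f u * A u w) * mat_power V A j w v)"
    by (subst sum.swap) (simp add: sum_distrib_right)
  also have "\<dots> = \<mu> * (\<Sum>w\<in>V. f w * mat_power V A j w v)"
    by (simp add: eig sum_distrib_left mult.assoc)
  finally show ?case
    by (simp add: Suc mult.assoc)
qed

text \<open>The finite sum over \<open>V\<close> is interchanged with the convergent series, leaving
  the exponential series of \<mu>.\<close>

lemma left_eigenvector_mat_exp:
  assumes "finite V" and "\<And>w. w \<in> V \<Longrightarrow> (\<Sum>u\<in>V. f u * A u w) = \<mu> * f w" and "v \<in> V"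
  shows "(\<Sum>u\<in>V. f u * mat_exp V A u v) = exp \<mu> * f v"
proof -
  have sm: "summable (\<lambda>j. f u * (mat_power V A j u v / fact j))" if "u \<in> V" for u
    using summable_mat_exp[OF \<open>finite V\<close> that \<open>v \<in> V\<close>] by (rule summable_mult)
  have "(\<Sum>u\<in>V. f u * mat_exp V A u v) = (\<Sum>u\<in>V. \<Sum>j. f u * (mat_power V A j u v / fact j))"
    unfolding mat_exp_def
    using summable_mat_exp[OF \<open>finite V\<close> _ \<open>v \<in> V\<close>] by (intro sum.cong refl suminf_mult[symmetric])
  also have "\<dots> = (\<Sum>j. \<Sum>u\<in>V. f u * (mat_power V A j u v / fact j))"
    using sm by (rule suminf_sum[symmetric])
  also have "\<dots> = (\<Sum>j. \<mu> ^ j /\<^sub>R fact j * f v)"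
    by (simp add: left_eigenvector_mat_power[OF assms] scaleR_conv_of_real field_simps
        flip: sum_divide_distrib)
  also have "\<dots> = exp \<mu> * f v"
    unfolding exp_def by (intro suminf_mult2[symmetric] summable_exp_generic)
  finally show ?thesis .
qed

text \<open>Edges are unordered pairs, so the adjacency matrix is symmetric and the eigenvector
  \<open>f\<close> also acts from the left. The bilinear pairing of \<open>f\<close> with column
  \<open>u\<close> of the transition matrix (no conjugation) is then computed twice: by the
  eigenvalue, and by the revival equation.\<close>

lemma revival_at_eigenvector:
  assumes "finite V" and rev: "revival_at V E \<alpha> \<beta> u v t"
    and eig: "\<And>w. w \<in> V \<Longrightarrow> mat_vec V (adj_matrix E) f w = \<mu> * f w"
  shows "exp (\<i> * of_real t * \<mu>) * f u = \<alpha> * f u + \<beta> * f v"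
proof -
  let ?H = "transition_matrix V E t"
  have uv: "u \<in> V" "v \<in> V"
    and H: "\<And>w. w \<in> V \<Longrightarrow> mat_vec V ?H (unit_vec u) w = \<alpha> * unit_vec u w + \<beta> * unit_vec v w"
    using rev by (auto simp: revival_at_def)
  have "(\<Sum>w\<in>V. f w * (\<i> * of_real t * adj_matrix E w x)) = \<i> * of_real t * \<mu> * f x"
    if "x \<in> V" for x
  proof -
    have "(\<Sum>w\<in>V. f w * (\<i> * of_real t * adj_matrix E w x)) =
          \<i> * of_real t * mat_vec V (adj_matrix E) f x"
      by (simp add: mat_vec_def sum_distrib_left adj_matrix_def insert_commute mult_ac)
    then show ?thesis
      by (simp add: eig[OF that])
  qed
  then have "exp (\<i> * of_real t * \<mu>) * f u = (\<Sum>w\<in>V. f w * ?H w u)"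
    unfolding transition_matrix_def using uv
    by (intro left_eigenvector_mat_exp[OF \<open>finite V\<close>, symmetric])
  also have "\<dots> = (\<Sum>w\<in>V. f w * mat_vec V ?H (unit_vec u) w)"
    using \<open>finite V\<close> uv by (simp add: mat_vec_def unit_vec_def if_distrib cong: if_cong)
  also have "\<dots> = (\<Sum>w\<in>V. \<alpha> * (f w * unit_vec u w) + \<beta> * (f w * unit_vec v w))"
    by (intro sum.cong) (auto simp: H algebra_simps)
  also have "\<dots> = \<alpha> * (\<Sum>w\<in>V. f w * unit_vec u w) + \<beta> * (\<Sum>w\<in>V. f w * unit_vec v w)"
    by (simp add: sum.distrib sum_distrib_left)
  also have "\<dots> = \<alpha> * f u + \<beta> * f v"
    using \<open>finite V\<close> uv by (simp add: unit_vec_def if_distrib cong: if_cong)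
  finally show ?thesis .
qed

section \<open>Greatest common divisors of exponents\<close>

text \<open>The integers \<open>m\<close> with \<open>w powi m = 1\<close> form a subgroup of the
  integers, hence contain gcds by Bezout. The coefficients may be negative, which is where
  \<open>w \<noteq> 0\<close> enters. The empty set has gcd 0, and
  \<open>w powi 0 = 1\<close>.\<close>

lemma powi_Gcd_eq_1:
  fixes w :: complex
  assumes "finite X" "w \<noteq> 0" "\<And>m. m \<in> X \<Longrightarrow> w powi m = 1"
  shows "w powi Gcd X = 1"
  using assms(1,3)
proof (induction X)
  case empty
  then show ?case by simp
next
  case (insert m X)
  obtain p q where "p * m + q * Gcd X = gcd m (Gcd X)"
    using bezout_int by blast
  then have "w powi Gcd (insert m X) = (w powi m) powi p * (w powi Gcd X) powi q"
    using \<open>w \<noteq> 0\<close> by (simp add: power_int_add power_int_mult[symmetric] mult.commute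
        flip: \<open>p * m + q * Gcd X = gcd m (Gcd X)\<close>)
  then show ?case
    using insert by simp
qed

lemma powi_int_gcd_eq_1:
  fixes w :: complex
  assumes "finite X" "w \<noteq> 0" "\<And>m. of_int m \<in> X \<Longrightarrow> w powi m = 1"
  shows "w powi int_gcd X = 1"
proof -
  have "finite {m::int. of_int m \<in> X}"
    using finite_vimageI[OF \<open>finite X\<close>, of "of_int :: int \<Rightarrow> complex"]
    by (simp add: vimage_def inj_on_def)
  then show ?thesis
    unfolding int_gcd_def using assms by (intro powi_Gcd_eq_1) auto
qed

lemma exp_powi: "exp (x :: complex) powi m = exp (of_int m * x)"
  by (simp add: exp_power_int)

text \<open>For every integer \<open>m\<close> among the differences, \<open>exp x powi m\<close> is
  the quotient of the two equal exponentials. This is the form in which all the gcds of the theorem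
  are used.\<close>

lemma exp_int_gcd_eq_1:
  assumes "finite Z" "\<And>z. z \<in> Z \<Longrightarrow> exp (x * p z) = exp (x * q z)"
  shows "exp (x :: complex) powi int_gcd {p z - q z | z. z \<in> Z} = 1"
proof (rule powi_int_gcd_eq_1)
  show "finite {p z - q z | z. z \<in> Z}"
    using assms(1) by (simp add: setcompr_eq_image)
  fix m assume "(of_int m :: complex) \<in> {p z - q z | z. z \<in> Z}"
  then obtain z where z: "z \<in> Z" "of_int m = p z - q z"
    by auto
  have "exp x powi m = exp (x * p z - x * q z)"
    by (simp add: exp_powi z mult.commute[of _ x] right_diff_distrib del: of_int_diff)
  then show "exp x powi m = 1"
    using assms(2)[OF z(1)] by (simp add: exp_diff)
qed simp

lemma exp_mult_Ints_eq_1: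
  assumes "exp (x :: complex) = 1" "y \<in> \<int>"
  shows "exp (x * y) = 1"
proof -
  obtain m where "y = of_int m"
    using assms(2) by (auto elim: Ints_cases)
  then show ?thesis
    using assms(1) exp_powi[of x m] by (simp add: mult.commute)
qed

section \<open>Eigenvectors of semi-Cayley graphs\<close>

lemma root_of_unity_exp_power: "m > 0 \<Longrightarrow> root_of_unity_exp m ^ m = 1"
  by (simp add: root_of_unity_exp_def exp_of_nat_mult[symmetric])

text \<open>Coordinates under \<phi> add only modulo \<open>n s\<close>; this removes the reduction
  from the exponent.\<close>

lemma root_of_unity_exp_powi_mod:
  assumes "m > 0"
  shows "root_of_unity_exp m powi (i * (j mod int m)) = root_of_unity_exp m powi (i * j)"
proof -
  let ?w = "root_of_unity_exp m"
  have nz: "?w \<noteq> 0"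
    by (simp add: root_of_unity_exp_def)
  have "i * j = i * (j mod int m) + int m * (i * (j div int m))"
    by (metis add.commute distrib_left mult.left_commute mult_div_mod_eq)
  then have "?w powi (i * j) = ?w powi (i * (j mod int m)) * (?w powi int m) powi (i * (j div int m))"
    using nz by (simp add: power_int_add power_int_mult)
  then show ?thesis
    using root_of_unity_exp_power[OF assms] by (simp add: power_int_def)
qed

lemma exists_phase: "\<exists>c. c * of_real (cmod y) = y \<and> cmod c = 1"
  by (metis complex_norm_eq_1_exp mult.commute norm_cis rcis_cmod_Arg rcis_def)

lemma finite_sc_verts: "finite (carrier G) \<Longrightarrow> finite (sc_verts G)"
  by (simp add: sc_verts_def)

lemma sum_sc_verts:
  assumes "finite (carrier G)"
  shows "(\<Sum>v\<in>sc_verts G. F v) = (\<Sum>y\<in>carrier G. F (y, 0)) + (\<Sum>y\<in>carrier G. F (y, 1))"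
proof -
  have "(\<Sum>v\<in>sc_verts G. F v) = (\<Sum>y\<in>carrier G. \<Sum>i\<in>{0, 1}. F (y, i))"
    by (simp only: sc_verts_def sum.cartesian_product case_prod_eta)
  then show ?thesis
    by (simp add: sum.distrib)
qed

locale semi_cayley = comm_group G for G (structure) +
  fixes k :: nat and n :: "nat \<Rightarrow> nat" and \<phi> :: "'a \<Rightarrow> nat \<Rightarrow> int" and R S :: "'a set"
  assumes fin: "finite (carrier G)"
    and n_pos: "s < k \<Longrightarrow> n s > 0"
    and \<phi>_iso: "\<phi> \<in> iso G (product_group {..<k} (\<lambda>s. integer_mod_group (n s)))"
    and R_sub: "R \<subseteq> carrier G" and S_sub: "S \<subseteq> carrier G"
    and R_inv: "R = set_inv R"
begin

abbreviation "\<psi> \<equiv> gchar k n \<phi>"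
abbreviation "\<Psi> \<equiv> gchar_set k n \<phi>"
abbreviation "A \<equiv> adj_matrix (sc_edges G R R S)"

section \<open>Multiplicativity and conjugation of characters\<close>

lemma \<phi>_mult:
  assumes "x \<in> carrier G" "y \<in> carrier G" "s < k"
  shows "\<phi> (x \<otimes> y) s = (\<phi> x s + \<phi> y s) mod int (n s)"
proof -
  have "\<phi> (x \<otimes> y) = \<phi> x \<otimes>\<^bsub>product_group {..<k} (\<lambda>s. integer_mod_group (n s))\<^esub> \<phi> y"
    using \<phi>_iso assms by (auto simp: iso_def hom_def)
  then show ?thesis
    using assms n_pos[of s] by (simp add: mult_integer_mod_group)
qed

lemma \<phi>_one:
  assumes "s < k"
  shows "\<phi> \<one> s = 0"
proof -
  have "group_hom G (product_group {..<k} (\<lambda>s. integer_mod_group (n s))) \<phi>"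
    using \<phi>_iso by (auto simp: group_hom_def group_hom_axioms_def iso_def is_group)
  from group_hom.hom_one[OF this] show ?thesis
    using assms by simp
qed

lemma gchar_mult:
  assumes "x \<in> carrier G" "y \<in> carrier G"
  shows "\<psi> z (x \<otimes> y) = \<psi> z x * \<psi> z y"
  unfolding gchar_def prod.distrib[symmetric]
proof (intro prod.cong refl)
  fix s assume "s \<in> {..<k}"
  then have "root_of_unity_exp (n s) powi (\<phi> z s * \<phi> (x \<otimes> y) s) =
      root_of_unity_exp (n s) powi (\<phi> z s * (\<phi> x s + \<phi> y s))"
    using assms by (simp add: \<phi>_mult root_of_unity_exp_powi_mod n_pos)
  also have "\<dots> = root_of_unity_exp (n s) powi (\<phi> z s * \<phi> x s) *
      root_of_unity_exp (n s) powi (\<phi> z s * \<phi> y s)"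
    by (simp add: distrib_left power_int_add root_of_unity_exp_def)
  finally show "root_of_unity_exp (n s) powi (\<phi> z s * \<phi> (x \<otimes> y) s) = \<dots>" .
qed

lemma norm_gchar [simp]: "cmod (\<psi> z x) = 1"
proof -
  have "cmod (root_of_unity_exp m) = 1" for m
    by (simp add: root_of_unity_exp_def)
  then show ?thesis
    by (simp add: gchar_def norm_power_int flip: prod_norm)
qed

lemma gchar_nonzero [simp]: "\<psi> z x \<noteq> 0"
  using norm_gchar[of z x] by force

lemma cnj_gchar: "cnj (\<psi> z x) = inverse (\<psi> z x)"
  using complex_div_cnj[of 1 "\<psi> z x"] by (simp add: divide_inverse)

lemma gchar_one_right: "\<psi> z \<one> = 1"
  using gchar_mult[of \<one> \<one> z] by simp

lemma gchar_inv:
  assumes "x \<in> carrier G"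
  shows "\<psi> z (inv x) = inverse (\<psi> z x)"
proof -
  have "\<psi> z (inv x) * \<psi> z x = 1"
    using assms gchar_mult[of "inv x" x z] by (simp add: gchar_one_right)
  then show ?thesis
    by (metis inverse_unique mult.commute)
qed

lemma gchar_one_left: "\<psi> \<one> x = 1"
  by (simp add: gchar_def \<phi>_one)

lemma gchar_set_one: "\<Psi> \<one> Y = of_nat (card Y)"
  by (simp add: gchar_set_def gchar_one_left)

lemma cnj_gchar_set: "cnj (\<Psi> z Y) = (\<Sum>y\<in>Y. inverse (\<psi> z y))"
  by (simp add: gchar_set_def cnj_gchar)

section \<open>Adjacency and sums of a character over neighbourhoods\<close>

lemma R_inv_closed: "x \<in> R \<Longrightarrow> inv x \<in> R"
  using R_inv by (auto simp: SET_INV_def)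

text \<open>Within a level an edge may arise from either ordering of its ends, and
  \<open>R = set_inv R\<close> makes both conditions agree. Between levels the end on level 0
  determines the orientation, so both matrix entries test the same element.\<close>

lemma adj_simps:
  assumes "x \<in> carrier G" "y \<in> carrier G"
  shows "A (x, 0) (y, 0) = (if y \<otimes> inv x \<in> R then 1 else 0)"
    and "A (x, 1) (y, 1) = (if y \<otimes> inv x \<in> R then 1 else 0)"
    and "A (x, 0) (y, 1) = (if y \<otimes> inv x \<in> S then 1 else 0)"
    and "A (y, 1) (x, 0) = (if y \<otimes> inv x \<in> S then 1 else 0)"
proof -
  have "x \<otimes> inv y \<in> R \<Longrightarrow> y \<otimes> inv x \<in> R"
    using R_inv_closed[of "x \<otimes> inv y"] assms by (simp add: inv_mult_group)
  with assms show "A (x, 0) (y, 0) = (if y \<otimes> inv x \<in> R then 1 else 0)"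
    "A (x, 1) (y, 1) = (if y \<otimes> inv x \<in> R then 1 else 0)"
    "A (x, 0) (y, 1) = (if y \<otimes> inv x \<in> S then 1 else 0)"
    "A (y, 1) (x, 0) = (if y \<otimes> inv x \<in> S then 1 else 0)"
    by (auto simp: adj_matrix_def sc_edges_def doubleton_eq_iff)
qed

text \<open>The \<open>y\<close> that are counted form the translate of \<open>Y\<close> by
  \<open>x\<close>.\<close>

lemma sum_gchar_translate:
  assumes "Y \<subseteq> carrier G" "x \<in> carrier G"
  shows "(\<Sum>y\<in>carrier G. (if y \<otimes> inv x \<in> Y then 1 else 0) * \<psi> z y) = \<Psi> z Y * \<psi> z x"
proof -
  have "(\<Sum>y\<in>carrier G. (if y \<otimes> inv x \<in> Y then 1 else 0) * \<psi> z y) =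
        (\<Sum>y\<in>{y\<in>carrier G. y \<otimes> inv x \<in> Y}. \<psi> z y)"
    using fin by (intro sum.mono_neutral_cong_right) auto
  also have "\<dots> = (\<Sum>y\<in>Y. \<psi> z (y \<otimes> x))"
    using assms
    by (intro sum.reindex_bij_witness[where i = "\<lambda>y. y \<otimes> x" and j = "\<lambda>y. y \<otimes> inv x"])
      (auto simp: m_assoc subset_iff)
  also have "\<dots> = \<Psi> z Y * \<psi> z x"
    unfolding gchar_set_def sum_distrib_right
    using assms by (intro sum.cong refl gchar_mult) auto
  finally show ?thesis .
qed

text \<open>Here the edges are followed backwards: the \<open>x\<close> that are counted are the
  products \<open>inv p \<otimes> y\<close> with \<open>p \<in> Y\<close>, and a character of
  modulus 1 turns inversion into conjugation.\<close>

lemma sum_gchar_translate_inv: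
  assumes "Y \<subseteq> carrier G" "y \<in> carrier G"
  shows "(\<Sum>x\<in>carrier G. (if y \<otimes> inv x \<in> Y then 1 else 0) * \<psi> z x) = cnj (\<Psi> z Y) * \<psi> z y"
proof -
  have cancel: "y \<otimes> (x \<otimes> inv y) = x" if "x \<in> carrier G" for x
    using that assms by (simp add: m_lcomm)
  have "(\<Sum>x\<in>carrier G. (if y \<otimes> inv x \<in> Y then 1 else 0) * \<psi> z x) =
        (\<Sum>x\<in>{x\<in>carrier G. y \<otimes> inv x \<in> Y}. \<psi> z x)"
    using fin by (intro sum.mono_neutral_cong_right) auto
  also have "\<dots> = (\<Sum>x\<in>Y. \<psi> z (inv x \<otimes> y))"
    using assms cancel
    by (intro sum.reindex_bij_witness[where i = "\<lambda>x. inv x \<otimes> y" and j = "\<lambda>x. y \<otimes> inv x"])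
      (auto simp: m_assoc subset_iff inv_mult_group m_comm)
  also have "\<dots> = cnj (\<Psi> z Y) * \<psi> z y"
    unfolding cnj_gchar_set sum_distrib_right
    using assms by (intro sum.cong refl) (auto simp: gchar_mult gchar_inv subset_iff)
  finally show ?thesis .
qed

section \<open>Eigenvectors attached to a character\<close>

definition eigvec :: "complex \<Rightarrow> complex \<Rightarrow> 'a \<Rightarrow> 'a \<times> nat \<Rightarrow> complex" where
  "eigvec c \<epsilon> z = (\<lambda>(x, i). (if i = 0 then c else \<epsilon>) * \<psi> z x)"

text \<open>On the copies of one character on the two levels, \<open>A\<close> acts as the 2x2
  matrix with diagonal entries \<open>\<Psi> z R\<close> and off-diagonal entries
  \<open>\<Psi> z S\<close> and its conjugate; \<open>(c, \<epsilon>)\<close> is an eigenvector of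
  it. If \<open>\<Psi> z S = 0\<close>, any phase \<open>c\<close> is allowed.\<close>

lemma mat_vec_eigvec:
  assumes c: "c * of_real (cmod (\<Psi> z S)) = \<Psi> z S" "cmod c = 1" and \<epsilon>: "\<epsilon> \<in> {1, -1}"
    and w: "w \<in> sc_verts G"
  shows "mat_vec (sc_verts G) A (eigvec c \<epsilon> z) w =
    (\<Psi> z R + \<epsilon> * of_real (cmod (\<Psi> z S))) * eigvec c \<epsilon> z w"
proof -
  obtain x i where xi: "w = (x, i)" "x \<in> carrier G" "i = 0 \<or> i = 1"
    using w by (auto simp: sc_verts_def)
  have "cnj (\<Psi> z S) = cnj c * of_real (cmod (\<Psi> z S))"
    using c(1) by (metis complex_cnj_complex_of_real complex_cnj_mult)
  moreover have "c * cnj c = 1"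
    using c(2) complex_norm_square[of c] by simp
  ultimately have cc: "c * cnj (\<Psi> z S) = of_real (cmod (\<Psi> z S))"
    by (simp flip: mult.assoc)
  have \<epsilon>2: "\<epsilon> * \<epsilon> = 1"
    using \<epsilon> by auto
  from xi(3) show ?thesis
  proof
    assume "i = 0"
    then have "mat_vec (sc_verts G) A (eigvec c \<epsilon> z) w =
        (\<Sum>y\<in>carrier G. c * ((if y \<otimes> inv x \<in> R then 1 else 0) * \<psi> z y)) +
        (\<Sum>y\<in>carrier G. \<epsilon> * ((if y \<otimes> inv x \<in> S then 1 else 0) * \<psi> z y))"
      unfolding mat_vec_def sum_sc_verts[OF fin]
      by (intro arg_cong2[where f = "(+)"] sum.cong refl)
        (simp_all add: xi adj_simps eigvec_def del: One_nat_def)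
    also have "\<dots> = c * (\<Psi> z R * \<psi> z x) + \<epsilon> * (\<Psi> z S * \<psi> z x)"
      unfolding sum_distrib_left[symmetric]
      by (simp only: sum_gchar_translate[OF R_sub xi(2)] sum_gchar_translate[OF S_sub xi(2)])
    also have "\<dots> = c * (\<Psi> z R * \<psi> z x) + \<epsilon> * (c * of_real (cmod (\<Psi> z S)) * \<psi> z x)"
      by (simp only: c(1))
    also have "\<dots> = (\<Psi> z R + \<epsilon> * of_real (cmod (\<Psi> z S))) * (c * \<psi> z x)"
      by (simp add: algebra_simps)
    finally show ?thesis
      using \<open>i = 0\<close> by (simp add: xi eigvec_def)
  next
    assume "i = 1"
    then have "mat_vec (sc_verts G) A (eigvec c \<epsilon> z) w =
        (\<Sum>y\<in>carrier G. c * ((if x \<otimes> inv y \<in> S then 1 else 0) * \<psi> z y)) +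
        (\<Sum>y\<in>carrier G. \<epsilon> * ((if y \<otimes> inv x \<in> R then 1 else 0) * \<psi> z y))"
      unfolding mat_vec_def sum_sc_verts[OF fin]
      by (intro arg_cong2[where f = "(+)"] sum.cong refl)
        (simp_all add: xi adj_simps eigvec_def del: One_nat_def)
    also have "\<dots> = c * (cnj (\<Psi> z S) * \<psi> z x) + \<epsilon> * (\<Psi> z R * \<psi> z x)"
      unfolding sum_distrib_left[symmetric]
      by (simp only: sum_gchar_translate[OF R_sub xi(2)] sum_gchar_translate_inv[OF S_sub xi(2)])
    \<comment> \<open>The factor \<open>\<epsilon> * \<epsilon> = 1\<close> is inserted so that
      \<epsilon>, the level 1 coefficient, can be pulled out.\<close>
    also have "\<dots> = \<epsilon> * (\<Psi> z R * \<psi> z x) + \<epsilon> * \<epsilon> * of_real (cmod (\<Psi> z S)) * \<psi> z x"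
      by (simp add: cc \<epsilon>2 flip: mult.assoc)
    also have "\<dots> = (\<Psi> z R + \<epsilon> * of_real (cmod (\<Psi> z S))) * (\<epsilon> * \<psi> z x)"
      by (simp add: algebra_simps)
    finally show ?thesis
      using \<open>i = 1\<close> by (simp add: xi eigvec_def)
  qed
qed

text \<open>This carries the integrality of the graph's eigenvalues over to the character formulas.
  The eigenvector is nonzero since its value at \<open>(\<one>, 0)\<close> is the phase
  \<open>c\<close>.\<close>

lemma mat_eigenvalue_lambda:
  shows "mat_eigenvalue (sc_verts G) A (lambda_plus k n \<phi> R S z)"
    and "mat_eigenvalue (sc_verts G) A (lambda_minus k n \<phi> R S z)"
proof -
  obtain c where c: "c * of_real (cmod (\<Psi> z S)) = \<Psi> z S" "cmod c = 1"
    using exists_phase by blast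
  have "\<exists>v\<in>sc_verts G. eigvec c \<epsilon> z v \<noteq> 0" for \<epsilon>
    using c(2) by (intro bexI[of _ "(\<one>, 0)"]) (auto simp: eigvec_def sc_verts_def)
  with mat_vec_eigvec[OF c]
  have "mat_eigenvalue (sc_verts G) A (\<Psi> z R + \<epsilon> * of_real (cmod (\<Psi> z S)))"
    if "\<epsilon> \<in> {1, -1}" for \<epsilon>
    unfolding mat_eigenvalue_def using that by blast
  from this[of 1] this[of "-1"]
  show "mat_eigenvalue (sc_verts G) A (lambda_plus k n \<phi> R S z)"
    "mat_eigenvalue (sc_verts G) A (lambda_minus k n \<phi> R S z)"
    by (simp_all add: lambda_plus_def lambda_minus_def)
qed

text \<open>The numbers |R| + |S| and |R| - |S| are the eigenvalues of the trivial character, so the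
  gcds containing them compare \<open>z\<close> with the identity.\<close>

lemma lambda_one:
  "lambda_plus k n \<phi> R S \<one> = of_nat (card R) + of_nat (card S)"
  "lambda_minus k n \<phi> R S \<one> = of_nat (card R) - of_nat (card S)"
  by (simp_all add: lambda_plus_def lambda_minus_def gchar_set_one)

section \<open>The revival equation evaluated on the eigenvectors\<close>

lemma revival_eigvec:
  assumes "revival_at (sc_verts G) (sc_edges G R R S) \<alpha> \<beta> u v t"
    and "c * of_real (cmod (\<Psi> z S)) = \<Psi> z S" "cmod c = 1" "\<epsilon> \<in> {1, -1}"
  shows "exp (\<i> * of_real t * (\<Psi> z R + \<epsilon> * of_real (cmod (\<Psi> z S)))) * eigvec c \<epsilon> z u =
    \<alpha> * eigvec c \<epsilon> z u + \<beta> * eigvec c \<epsilon> z v"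
  using revival_at_eigenvector[OF finite_sc_verts[OF fin] assms(1)] mat_vec_eigvec[OF assms(2-4)]
  by blast

lemma gchar_diff:
  assumes "g \<in> carrier G" "h \<in> carrier G"
  shows "\<psi> z h = \<psi> z (inv g \<otimes> h) * \<psi> z g"
  using assms by (simp add: gchar_mult gchar_inv)

text \<open>On one level the eigenvector values at \<open>h\<close> and \<open>g\<close> differ by
  the factor \<open>\<psi> z (inv g \<otimes> h)\<close>, whatever \<epsilon> is; hence both signs
  give the same right-hand side.\<close>

lemma revival_same_level:
  assumes rev: "revival_at (sc_verts G) (sc_edges G R R S) \<alpha> \<beta> (g, r) (h, r) t"
    and gh: "g \<in> carrier G" "h \<in> carrier G"
  shows "exp (\<i> * of_real t * lambda_plus k n \<phi> R S z) = \<alpha> + \<beta> * \<psi> z (inv g \<otimes> h)"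
    and "exp (\<i> * of_real t * lambda_minus k n \<phi> R S z) = \<alpha> + \<beta> * \<psi> z (inv g \<otimes> h)"
proof -
  obtain c where c: "c * of_real (cmod (\<Psi> z S)) = \<Psi> z S" "cmod c = 1"
    using exists_phase by blast
  have "exp (\<i> * of_real t * (\<Psi> z R + \<epsilon> * of_real (cmod (\<Psi> z S)))) = \<alpha> + \<beta> * \<psi> z (inv g \<otimes> h)"
    if \<epsilon>: "\<epsilon> \<in> {1, -1}" for \<epsilon>
  proof -
    have h: "eigvec c \<epsilon> z (h, r) = \<psi> z (inv g \<otimes> h) * eigvec c \<epsilon> z (g, r)"
      by (simp add: eigvec_def gchar_diff[OF gh])
    have "eigvec c \<epsilon> z (g, r) \<noteq> 0"
      using c(2) \<epsilon> by (auto simp: eigvec_def)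
    with revival_eigvec[OF rev c \<epsilon>] show ?thesis
      unfolding h by (metis (no_types, opaque_lifting) distrib_right mult.assoc mult_right_cancel)
  qed
  from this[of 1] this[of "-1"]
  show "exp (\<i> * of_real t * lambda_plus k n \<phi> R S z) = \<alpha> + \<beta> * \<psi> z (inv g \<otimes> h)"
    "exp (\<i> * of_real t * lambda_minus k n \<phi> R S z) = \<alpha> + \<beta> * \<psi> z (inv g \<otimes> h)"
    by (simp_all add: lambda_plus_def lambda_minus_def)
qed

text \<open>
  The phase c of \<open>\<Psi> z S\<close> is taken to be the inverse of \<open>\<delta> * \<psi> z b\<close>, which is a legitimate choice
  also when \<open>\<Psi> z S = 0\<close>; so this case needs no separate treatment.
\<close>

lemma revival_different_level:
  assumes rev: "revival_at (sc_verts G) (sc_edges G R R S) \<alpha> \<beta> (g, r) (h, s) t"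
    and gh: "g \<in> carrier G" "h \<in> carrier G" and rs: "r \<in> {0, 1}" "s \<in> {0, 1}" "r \<noteq> s"
    and b: "b = level_shift G r (inv g \<otimes> h)"
    and \<delta>: "\<delta> \<in> {1, -1}" and z: "\<Psi> z S * \<psi> z b = \<delta> * of_real (cmod (\<Psi> z S))"
  shows "exp (\<i> * of_real t * lambda_plus k n \<phi> R S z) = \<alpha> + \<delta> * \<beta>"
    and "exp (\<i> * of_real t * lambda_minus k n \<phi> R S z) = \<alpha> - \<delta> * \<beta>"
proof -
  define c where "c = \<delta> * inverse (\<psi> z b)"
  have c: "c * of_real (cmod (\<Psi> z S)) = \<Psi> z S" "cmod c = 1"
    using \<delta> z by (auto simp: c_def norm_mult norm_inverse norm_divide field_simps)
  have \<delta>2: "\<delta> * \<delta> = 1"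
    using \<delta> by auto
  have "exp (\<i> * of_real t * (\<Psi> z R + \<epsilon> * of_real (cmod (\<Psi> z S)))) = \<alpha> + \<beta> * (\<epsilon> * \<delta>)"
    if \<epsilon>: "\<epsilon> \<in> {1, -1}" for \<epsilon>
  proof -
    \<comment> \<open>Let \<open>a = inv g \<otimes> h\<close>. If \<open>r = 0\<close>, then
      \<open>c = \<delta> * \<psi> z a\<close> and the ratio of the values is
      \<open>\<epsilon> * \<psi> z a / c\<close>; if \<open>r = 1\<close>, then
      \<open>c = \<delta> * inverse (\<psi> z a)\<close> and it is
      \<open>c * \<psi> z a / \<epsilon>\<close>. Both equal \<open>\<epsilon> * \<delta>\<close>,
      which is what \<open>level_shift\<close> achieves.\<close>
    have h: "eigvec c \<epsilon> z (h, s) = \<epsilon> * \<delta> * eigvec c \<epsilon> z (g, r)"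
      using rs \<epsilon> \<delta> gh
      by (auto simp: eigvec_def gchar_diff[OF gh] c_def b level_shift_def gchar_inv simp del: One_nat_def)
    have "eigvec c \<epsilon> z (g, r) \<noteq> 0"
      using c(2) \<epsilon> by (auto simp: eigvec_def)
    with revival_eigvec[OF rev c \<epsilon>] show ?thesis
      unfolding h by (metis (no_types, opaque_lifting) distrib_right mult.assoc mult_right_cancel)
  qed
  from this[of 1] this[of "-1"]
  show "exp (\<i> * of_real t * lambda_plus k n \<phi> R S z) = \<alpha> + \<delta> * \<beta>"
    "exp (\<i> * of_real t * lambda_minus k n \<phi> R S z) = \<alpha> - \<delta> * \<beta>"
    by (simp_all add: lambda_plus_def lambda_minus_def mult.commute)
qed

end

section \<open>Exclusion of revival when the gcd is 1\<close>

theorem theorem5p4: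
  fixes G :: "('a, 'b) monoid_scheme"
    and k :: nat and n :: "nat \<Rightarrow> nat" and \<phi> :: "'a \<Rightarrow> nat \<Rightarrow> int"
    and R S :: "'a set" and \<alpha> \<beta> :: complex and g h a :: 'a
    and V :: "('a \<times> nat) set" and E :: "('a \<times> nat) set set"
    and ch :: "'a \<Rightarrow> 'a \<Rightarrow> complex" and chS lp lm :: "'a \<Rightarrow> complex"
    and cR cS :: complex
  assumes "comm_group G" and "finite (carrier G)"
    and "\<And>s. s < k \<Longrightarrow> n s > 0"
    and "\<phi> \<in> iso G (product_group {..<k} (\<lambda>s. integer_mod_group (n s)))"
    and "R \<subseteq> carrier G" and "S \<subseteq> carrier G"
    and "R = set_inv\<^bsub>G\<^esub> R" and "\<one>\<^bsub>G\<^esub> \<notin> R"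
    and "V = sc_verts G" and "E = sc_edges G R R S"
    and "\<And>\<mu>. mat_eigenvalue V (adj_matrix E) \<mu> \<Longrightarrow> \<mu> \<in> \<int>"
    and "\<alpha> \<noteq> 0" and "\<beta> \<noteq> 0"
    and "g \<in> carrier G" and "h \<in> carrier G" and "a = inv\<^bsub>G\<^esub> g \<otimes>\<^bsub>G\<^esub> h"
    and "ch = gchar k n \<phi>" and "chS = (\<lambda>z. gchar_set k n \<phi> z S)"
    and "lp = lambda_plus k n \<phi> R S" and "lm = lambda_minus k n \<phi> R S"
    and "cR = of_nat (card R)" and "cS = of_nat (card S)"
  shows "(\<forall>z\<^sub>1 r s.
            let G0 = {z \<in> carrier G. ch z a = 1};
                G1 = {z \<in> carrier G. ch z a = - 1};
                M0p = int_gcd {cR + cS - lp z | z. z \<in> G0};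
                M0m = int_gcd {cR - cS - lm z | z. z \<in> G0};
                M1p = int_gcd {lp z\<^sub>1 - lp z | z. z \<in> G1};
                M1m = int_gcd {lm z\<^sub>1 - lm z | z. z \<in> G1}
            in z\<^sub>1 \<in> G1 \<and> Gcd {M0p, M0m, M1p, M1m} = 1 \<and>
               r \<in> {0, 1} \<and> s \<in> {0, 1} \<and> r = s \<longrightarrow>
               \<not> revival_occurs V E \<alpha> \<beta> (g, r) (h, s))
       \<and> (\<forall>z\<^sub>1 r s.
            let b = level_shift G r a;
                H0 = {z \<in> carrier G. chS z * ch z b = of_real (cmod (chS z))};
                H1 = {z \<in> carrier G. chS z * ch z b = - of_real (cmod (chS z))};
                N0p = int_gcd {cR + cS - lp z | z. z \<in> H0};
                N0m = int_gcd {cR - cS - lm z | z. z \<in> H0};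
                N1p = int_gcd {cR + cS - lm z | z. z \<in> H1};
                N1m = int_gcd {cR - cS - lp z | z. z \<in> H1};
                N2p = int_gcd {lp z\<^sub>1 - lp z | z. z \<in> H1};
                N2m = int_gcd {lm z\<^sub>1 - lm z | z. z \<in> H1}
            in z\<^sub>1 \<in> H1 \<and> Gcd {N0p, N0m, N1p, N1m, N2p, N2m} = 1 \<and>
               r \<in> {0, 1} \<and> s \<in> {0, 1} \<and> r \<noteq> s \<longrightarrow>
               \<not> revival_occurs V E \<alpha> \<beta> (g, r) (h, s))"
proof -
  interpret semi_cayley G k n \<phi> R S
    using assms by (auto simp: semi_cayley_def semi_cayley_axioms_def)
  have int: "lp z \<in> \<int>" "lm z \<in> \<int>" for z
    using assms mat_eigenvalue_lambda[of z] by auto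
  have one: "cR + cS = lp \<one>\<^bsub>G\<^esub>" "cR - cS = lm \<one>\<^bsub>G\<^esub>"
    using assms lambda_one by auto
  have same: "\<not> revival_occurs V E \<alpha> \<beta> (g, r) (h, r)"
    if "z\<^sub>1 \<in> G1" and G0: "G0 = {z \<in> carrier G. ch z a = 1}"
      and G1: "G1 = {z \<in> carrier G. ch z a = - 1}"
      and gcd: "Gcd {int_gcd {cR + cS - lp z | z. z \<in> G0}, int_gcd {cR - cS - lm z | z. z \<in> G0},
        int_gcd {lp z\<^sub>1 - lp z | z. z \<in> G1}, int_gcd {lm z\<^sub>1 - lm z | z. z \<in> G1}} = 1"
    for z\<^sub>1 r G0 G1
  proof
    assume "revival_occurs V E \<alpha> \<beta> (g, r) (h, r)"
    then obtain t where "revival_at (sc_verts G) (sc_edges G R R S) \<alpha> \<beta> (g, r) (h, r) t"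
      using assms by (auto simp: revival_occurs_def)
    note rev = revival_same_level[OF this \<open>g \<in> carrier G\<close> \<open>h \<in> carrier G\<close>]
    define x where "x = \<i> * of_real t"
    have e: "exp (x * lp z) = \<alpha> + \<beta> * ch z a" "exp (x * lm z) = \<alpha> + \<beta> * ch z a" for z
      using rev assms by (simp_all add: x_def)
    have fin01: "finite G0" "finite G1" and "\<one>\<^bsub>G\<^esub> \<in> G0"
      using G0 G1 fin gchar_one_left assms by auto
    \<comment> \<open>On \<open>G0\<close> both exponentials equal \<alpha> + \<beta>, so
      \<open>z\<close> is compared with the identity; on \<open>G1\<close> both equal \<alpha> -
      \<beta>, so \<open>z\<close> is compared with \<open>z\<^sub>1\<close>.\<close>
    then have "exp x powi Gcd {int_gcd {cR + cS - lp z | z. z \<in> G0},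
        int_gcd {cR - cS - lm z | z. z \<in> G0},
        int_gcd {lp z\<^sub>1 - lp z | z. z \<in> G1}, int_gcd {lm z\<^sub>1 - lm z | z. z \<in> G1}} = 1"
      using \<open>z\<^sub>1 \<in> G1\<close> unfolding one
      by (intro powi_Gcd_eq_1)
        (auto intro!: exp_int_gcd_eq_1[OF fin01(1)] exp_int_gcd_eq_1[OF fin01(2)] simp: e, auto simp: G0 G1)
    then have "exp x = 1"
      unfolding gcd by simp
    then have "\<alpha> + \<beta> * ch z a = 1" for z
      using exp_mult_Ints_eq_1[OF _ int(1)] e(1) by metis
    from this[of "\<one>\<^bsub>G\<^esub>"] this[of z\<^sub>1] have "\<alpha> + \<beta> = 1" "\<alpha> - \<beta> = 1"
      using \<open>z\<^sub>1 \<in> G1\<close> \<open>\<one>\<^bsub>G\<^esub> \<in> G0\<close> by (simp_all add: G0 G1)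
    then have "((\<alpha> + \<beta>) - (\<alpha> - \<beta>)) / 2 = 0"
      by (simp only: diff_self div_0)
    then have "\<beta> = 0"
      by simp
    with \<open>\<beta> \<noteq> 0\<close> show False ..
  qed
  have different: "\<not> revival_occurs V E \<alpha> \<beta> (g, r) (h, s)"
    if rs: "r \<in> {0, 1}" "s \<in> {0, 1}" "r \<noteq> s" and b: "b = level_shift G r a"
      and "z\<^sub>1 \<in> H1" and H0: "H0 = {z \<in> carrier G. chS z * ch z b = of_real (cmod (chS z))}"
      and H1: "H1 = {z \<in> carrier G. chS z * ch z b = - of_real (cmod (chS z))}"
      and gcd: "Gcd {int_gcd {cR + cS - lp z | z. z \<in> H0}, int_gcd {cR - cS - lm z | z. z \<in> H0},
        int_gcd {cR + cS - lm z | z. z \<in> H1}, int_gcd {cR - cS - lp z | z. z \<in> H1},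
        int_gcd {lp z\<^sub>1 - lp z | z. z \<in> H1}, int_gcd {lm z\<^sub>1 - lm z | z. z \<in> H1}} = 1"
    for z\<^sub>1 r s b H0 H1
  proof
    assume "revival_occurs V E \<alpha> \<beta> (g, r) (h, s)"
    then obtain t where "revival_at (sc_verts G) (sc_edges G R R S) \<alpha> \<beta> (g, r) (h, s) t"
      using assms by (auto simp: revival_occurs_def)
    note rev = revival_different_level[OF this \<open>g \<in> carrier G\<close> \<open>h \<in> carrier G\<close> rs
        b[unfolded \<open>a = _\<close>]]
    define x where "x = \<i> * of_real t"
    have e0: "exp (x * lp z) = \<alpha> + \<beta>" "exp (x * lm z) = \<alpha> - \<beta>" if "z \<in> H0" for z
      using rev[of 1 z] that assms by (simp_all add: x_def H0)
    \<comment> \<open>The sign \<delta> = -1 on \<open>H1\<close> exchanges the two values.\<close>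
    have e1: "exp (x * lp z) = \<alpha> - \<beta>" "exp (x * lm z) = \<alpha> + \<beta>" if "z \<in> H1" for z
      using rev[of "-1" z] that assms by (simp_all add: x_def H1)
    \<comment> \<open>The identity lies in \<open>H0\<close> because its character sum over
      \<open>S\<close> is the nonnegative number |S|.\<close>
    have fin01: "finite H0" "finite H1" and "\<one>\<^bsub>G\<^esub> \<in> H0"
      using H0 H1 fin gchar_one_left gchar_set_one assms by auto
    \<comment> \<open>The mixed gcds pair opposite signs: \<open>lp\<close> at the identity and
      \<open>lm\<close> on \<open>H1\<close> both give \<alpha> + \<beta>, while \<open>lm\<close>
      at the identity and \<open>lp\<close> on \<open>H1\<close> both give \<alpha> -
      \<beta>.\<close>
    then have "exp x powi Gcd {int_gcd {cR + cS - lp z | z. z \<in> H0},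
        int_gcd {cR - cS - lm z | z. z \<in> H0},
        int_gcd {cR + cS - lm z | z. z \<in> H1}, int_gcd {cR - cS - lp z | z. z \<in> H1},
        int_gcd {lp z\<^sub>1 - lp z | z. z \<in> H1}, int_gcd {lm z\<^sub>1 - lm z | z. z \<in> H1}} = 1"
      using \<open>z\<^sub>1 \<in> H1\<close> unfolding one
      by (intro powi_Gcd_eq_1) (auto simp: e0 e1 intro!: exp_int_gcd_eq_1)
    then have "exp x = 1"
      unfolding gcd by simp
    \<comment> \<open>Both equations come from the identity, the first from \<open>lp\<close> and
      the second from \<open>lm\<close>.\<close>
    then have "\<alpha> + \<beta> = 1" "\<alpha> - \<beta> = 1"
      using exp_mult_Ints_eq_1[OF _ int(1)] exp_mult_Ints_eq_1[OF _ int(2)] e0[OF \<open>\<one>\<^bsub>G\<^esub> \<in> H0\<close>]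
      by metis+
    then have "((\<alpha> + \<beta>) - (\<alpha> - \<beta>)) / 2 = 0"
      by (simp only: diff_self div_0)
    then have "\<beta> = 0"
      by simp
    with \<open>\<beta> \<noteq> 0\<close> show False ..
  qed
  show ?thesis
    unfolding Let_def
  proof ((intro conjI allI impI; elim conjE), goal_cases)
    case (1 z\<^sub>1 r s)
    show ?case
      unfolding \<open>r = s\<close>[symmetric] by (rule same[OF 1(1) refl refl 1(2)])
  next
    case (2 z\<^sub>1 r s)
    show ?case
      by (rule different[OF 2(3-5) refl 2(1) refl refl 2(2)])
  qed
qed

end
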